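(* Let $\mathfrak k$ be a Lie subalgebra of $W$ with $\mathrm{codim}_W\mathfrak k=2$ and $|\mathrm{supp}(\mathfrak k)|=1$, so that $\mathrm{supp}(\mathfrak k)=\{x\}$ for some $x\in\Bbbk^\times$. (a) Either $\mathfrak k=W((t-x)^2)$ or $\mathrm{gaps}(\mathfrak k)$ is $\{1\}$ or $\{2\}$. (b) If $\mathrm{gaps}(\mathfrak k)=\{1\}$ then $\mathfrak k=W^{2;1}_{x;\alpha}$ for a unique $\alpha\in\Bbbk$. (c) If $\mathrm{gaps}(\mathfrak k)=\{2\}$ then $\mathfrak k=W^{2;2}_{x;\alpha}$ for a unique $\alpha\in\Bbbk$.
   Context: $\Bbbk$ is an uncountable algebraically closed field of characteristic $0$; $\partial=d/dt$. $W=\Bbbk[t,t^{-1}]\partial$ is the Witt algebra, with $[f\partial,g\partial]=(fg'-f'g)\partial$. For $f\in\Bbbk[t,t^{-1}]$, $W(f)=f\,\Bbbk[t,t^{-1}]\partial$. For a subalgebra $\mathfrak k\subseteq W$ of finite codimension, $\mathrm{supp}(\mathfrak k)=\{x\in\Bbbk^\times:\mathfrak k\subseteq W(t-x)\}$, and $f_{\mathfrak k}\in\Bbbk[t]$ is the lowest degree monic polynomial with $\mathfrak k\supseteq W(f_{\mathfrak k})$ (it exists and is unique, and $\mathfrak k\subseteq W(\mathrm{rad}(f_{\mathfrak k}))$, where $\mathrm{rad}(f)$ is the product of $t-y$ over the distinct roots $y\in\Bbbk^\times$ of $f$). Suppose $\mathrm{supp}(\mathfrak k)=\{x\}$ and let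 $d=\mathrm{codim}_W\mathfrak k$. Then $f_{\mathfrak k}=(t-x)^a$ with $a\geq d$, and $a=d$ if and only if $\mathfrak k=W((t-x)^d)$. If $a\neq d$, the set of orders of vanishing at $x$ of those $f$ with $f\partial\in\mathfrak k\setminus W(f_{\mathfrak k})$ and order of vanishing less than $a$ is a set $\{n_1<\dots<n_{a-d}\}\subseteq\{1,\dots,a-2\}$; writing $\{1,\dots,a-1\}\setminus\{n_1,\dots,n_{a-d}\}=\{g_1<\dots<g_{d-1}\}$, one sets $\mathrm{gaps}(\mathfrak k)=\{g_1-1,\dots,g_{d-1}-1\}$ (only defined when $a\neq d$). For $x\in\Bbbk^\times$ and $\alpha\in\Bbbk$: $W^{2;1}_{x;\alpha}=W((t-x)^3)+\Bbbk\bigl((t-x)+\alpha(t-x)^2\bigr)\partial$; $W^{2;2}_{x;\alpha}=W((t-x)^4)+\Bbbk\bigl((t-x)+\alpha(t-x)^3\bigr)\partial+\Bbbk(t-x)^2\partial$. *)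

theory Defs
  imports
    "HOL-Library.Poly_Mapping"
    "HOL-Library.Countable_Set"
    "HOL-Computational_Algebra.Polynomial"
begin

text \<open>
  Laurent polynomials are the monoid algebra of the integers: \<open>Poly_Mapping.single n c\<close> is the
  monomial \<open>c t^n\<close>, and the library multiplication on \<open>\<Rightarrow>\<^sub>0\<close> is convolution.
  An element \<open>f \<partial>\<close> of the Witt algebra is represented by its coefficient \<open>f\<close>, so the whole
  type is the Witt algebra and subsets of it are sets of vector fields.
\<close>

type_synonym 'a laurent = "int \<Rightarrow>\<^sub>0 'a"

definition lscale :: "'a::field \<Rightarrow> 'a laurent \<Rightarrow> 'a laurent" where
  "lscale c f = Poly_Mapping.single 0 c * f"

interpretation laurent: vector_space "lscale :: 'a::field \<Rightarrow> 'a laurent \<Rightarrow> 'a laurent"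
  by unfold_locales
     (simp_all add: lscale_def algebra_simps single_add mult_single flip: mult.assoc)

definition lderiv :: "'a::field laurent \<Rightarrow> 'a laurent" where
  "lderiv f = (\<Sum>n\<in>Poly_Mapping.keys f. Poly_Mapping.single (n - 1) (of_int n * Poly_Mapping.lookup f n))"

definition witt_bracket :: "'a::field laurent \<Rightarrow> 'a laurent \<Rightarrow> 'a laurent" where
  "witt_bracket f g = f * lderiv g - lderiv f * g"

definition lie_subalgebra :: "'a::field laurent set \<Rightarrow> bool" where
  "lie_subalgebra K \<longleftrightarrow>
     laurent.subspace K \<and> (\<forall>f\<in>K. \<forall>g\<in>K. witt_bracket f g \<in> K)"

text \<open>
  \<open>quotient_basis K B\<close> says that the cosets of the elements of \<open>B\<close> are pairwise distinct and
  form a basis of the quotient space of the Witt algebra by \<open>K\<close>.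
\<close>

definition quotient_basis :: "'a::field laurent set \<Rightarrow> 'a laurent set \<Rightarrow> bool" where
  "quotient_basis K B \<longleftrightarrow>
     (\<forall>S u. finite S \<and> S \<subseteq> B \<and> (\<Sum>b\<in>S. lscale (u b) b) \<in> K \<longrightarrow> (\<forall>b\<in>S. u b = 0)) \<and>
     (\<forall>w. \<exists>S u. finite S \<and> S \<subseteq> B \<and> w - (\<Sum>b\<in>S. lscale (u b) b) \<in> K)"

text \<open>
  As for the library dimension function, the value is \<open>0\<close> when the codimension is infinite; a
  positive value therefore means finite codimension.
\<close>

definition witt_codim :: "'a::field laurent set \<Rightarrow> nat" where
  "witt_codim K =
     (if \<exists>B. quotient_basis K B then card (SOME B. quotient_basis K B) else 0)"

definition witt_multiples :: "'a::field laurent \<Rightarrow> 'a laurent set" where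
  "witt_multiples f = {f * h | h. True}"

definition lin :: "'a::field \<Rightarrow> 'a laurent" where
  "lin x = Poly_Mapping.single 1 1 - Poly_Mapping.single 0 x"

definition witt_supp :: "'a::field laurent set \<Rightarrow> 'a set" where
  "witt_supp K = {x. x \<noteq> 0 \<and> K \<subseteq> witt_multiples (lin x)}"

definition laurent_of_poly :: "'a::field poly \<Rightarrow> 'a laurent" where
  "laurent_of_poly p = (\<Sum>i\<le>Polynomial.degree p. Poly_Mapping.single (int i) (coeff p i))"

text \<open>
  The monic polynomial \<open>f\<close> of lowest degree such that \<open>K\<close> contains all multiples of \<open>f\<close>;
  it exists and is unique for subalgebras of finite codimension.
\<close>

definition witt_conductor :: "'a::field laurent set \<Rightarrow> 'a poly" where
  "witt_conductor K =
     (THE p. lead_coeff p = 1 \<and> witt_multiples (laurent_of_poly p) \<subseteq> K \<and>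
        (\<forall>q. lead_coeff q = 1 \<and> witt_multiples (laurent_of_poly q) \<subseteq> K \<longrightarrow>
             Polynomial.degree p \<le> Polynomial.degree q))"

definition vanishing_order :: "'a::field \<Rightarrow> 'a laurent \<Rightarrow> nat" where
  "vanishing_order x f = (GREATEST n. lin x ^ n dvd f)"

text \<open>
  Only meaningful for subalgebras of finite codimension with one-point support \<open>{x}\<close>. The
  conductor polynomial is then \<open>(t - x)^a\<close>, so \<open>a\<close> is recovered as its degree. The value
  \<open>None\<close> encodes that the gaps are not defined when \<open>a\<close> equals the codimension.
\<close>

definition gaps :: "'a::field laurent set \<Rightarrow> nat set option" where
  "gaps K =
     (let x = the_elem (witt_supp K);
          p = witt_conductor K;
          a = Polynomial.degree p;
          ords = {vanishing_order x f | f.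
                    f \<in> K - witt_multiples (laurent_of_poly p) \<and> vanishing_order x f < a}
      in if a = witt_codim K then None
         else Some ((\<lambda>g. g - 1) ` ({1..a - 1} - ords)))"

definition W21 :: "'a::field \<Rightarrow> 'a \<Rightarrow> 'a laurent set" where
  "W21 x \<alpha> =
     {w + lscale c (lin x + lscale \<alpha> (lin x ^ 2)) | w c. w \<in> witt_multiples (lin x ^ 3)}"

definition W22 :: "'a::field \<Rightarrow> 'a \<Rightarrow> 'a laurent set" where
  "W22 x \<alpha> =
     {w + lscale c (lin x + lscale \<alpha> (lin x ^ 3)) + lscale e (lin x ^ 2) | w c e.
        w \<in> witt_multiples (lin x ^ 4)}"

end

theory Submission
  imports Defs
begin

text \<open>
  Write \<open>e_n\<close> for \<open>(t - x)^n \<partial>\<close>. Since \<open>W(t - x)\<close> has codimension one in the Witt algebra, \<open>K\<close> has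
  codimension one in \<open>W(t - x)\<close> (\<open>codim_2_dependent\<close>, \<open>codim_2_proper\<close>). The proof has two halves.

  The first half shows that the conductor of \<open>K\<close> is a power \<open>(t - x)^a\<close>. The elements \<open>f\<close> of \<open>K\<close>
  that act trivially on the line \<open>W(t - x) / K\<close> satisfy \<open>[f, f g] = f\<^sup>2 g'\<close>, so \<open>K\<close> contains \<open>f\<^sup>2 h\<close>
  for all \<open>h\<close> without residue. Polarizing this identity and playing two independent such elements
  against each other removes the residue condition (\<open>ex_multiples_subset\<close>), so that \<open>K\<close> contains
  all multiples of some nonzero polynomial. The polynomials of this kind form an ideal, and a root
  \<open>y \<noteq> x\<close> of its generator, nonzero because \<open>t\<close> is a unit, would be a common zero of \<open>K\<close> (\<open>conductor_root\<close>), hence a second point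
  of the support; over an algebraically closed field only a power of \<open>t - x\<close> remains.

  The second half is a computation with \<open>e_1, ..., e_(a-1)\<close> modulo \<open>W((t - x)^a)\<close>. By minimality of
  the conductor \<open>e_(a-1)\<close> is not in \<open>K\<close>, so it spans \<open>W(t - x) / K\<close>. Bracketing with
  \<open>e_1 + \<alpha> e_(a-1)\<close> gives \<open>e_n \<in> K\<close> for \<open>2 \<le> n \<le> a - 2\<close> (\<open>middle_power_mem\<close>), and then
  \<open>[e_2, e_(a-2)] = (a - 4) e_(a-1)\<close> excludes \<open>a \<ge> 5\<close> (\<open>exponent_le_4\<close>). So \<open>a\<close> is \<open>2\<close>, \<open>3\<close> or \<open>4\<close>. For
  \<open>a = 2\<close> the subalgebra is \<open>W((t - x)\<^sup>2)\<close>; for \<open>a = 3\<close> and \<open>a = 4\<close> the only gap is \<open>a - 2\<close>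
  (\<open>gaps_eq\<close>), and the coefficient \<open>\<alpha>\<close> is the only parameter left; it is unique because
  \<open>e_(a-1)\<close> is not in \<open>K\<close>.
\<close>

section \<open>The derivation on Laurent polynomials\<close>

abbreviation lconst :: "'a::field \<Rightarrow> 'a laurent" where
  "lconst c \<equiv> Poly_Mapping.single 0 c"

lemma lookup_lderiv: "Poly_Mapping.lookup (lderiv f) n = of_int (n + 1) * Poly_Mapping.lookup f (n + 1)"
proof -
  have "Poly_Mapping.lookup (lderiv f) n
      = (\<Sum>m\<in>Poly_Mapping.keys f. if m = n + 1 then of_int m * Poly_Mapping.lookup f m else 0)"
    unfolding lderiv_def lookup_sum by (rule sum.cong) (auto simp: lookup_single when_def)
  also have "\<dots> = of_int (n + 1) * Poly_Mapping.lookup f (n + 1)"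
    by (simp add: sum.delta in_keys_iff)
  finally show ?thesis .
qed

lemma lderiv_add: "lderiv (f + g) = lderiv f + lderiv g"
  by (rule poly_mapping_eqI) (simp add: lookup_lderiv lookup_add algebra_simps)

lemma lderiv_0 [simp]: "lderiv 0 = 0"
  by (simp add: lderiv_def)

lemma lderiv_single: "lderiv (Poly_Mapping.single n c) = Poly_Mapping.single (n - 1) (of_int n * c)"
  by (rule poly_mapping_eqI) (auto simp: lookup_lderiv lookup_single when_def)

lemma lderiv_sum: "lderiv (sum f A) = (\<Sum>i\<in>A. lderiv (f i))"
  by (induction A rule: infinite_finite_induct) (simp_all add: lderiv_add)

lemma sum_single_lookup:
  "(\<Sum>n\<in>Poly_Mapping.keys f. Poly_Mapping.single n (Poly_Mapping.lookup f n)) = f"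
  by (rule poly_mapping_eqI)
     (simp add: lookup_sum lookup_single when_def sum.delta in_keys_iff)

lemma laurent_induct [case_names single add]:
  assumes "\<And>n c. P (Poly_Mapping.single n c)" and "\<And>f g. P f \<Longrightarrow> P g \<Longrightarrow> P (f + g)"
  shows "P (f :: 'a::field laurent)"
proof -
  have "P (\<Sum>n\<in>A. Poly_Mapping.single n (Poly_Mapping.lookup f n))" if "finite A" for A
    using that
  proof (induction A)
    case empty
    show ?case using assms(1)[of 0 0] by simp
  qed (simp add: assms)
  from this[of "Poly_Mapping.keys f"] show ?thesis by (simp add: sum_single_lookup)
qed

lemma lderiv_mult: "lderiv (f * g) = f * lderiv g + lderiv f * (g :: 'a::field laurent)"
proof (induction f rule: laurent_induct)
  case (single m c)
  show ?case
  proof (induction g rule: laurent_induct)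
    case (single n d)
    have "Poly_Mapping.single m c * lderiv (Poly_Mapping.single n d)
          + lderiv (Poly_Mapping.single m c) * Poly_Mapping.single n d
        = Poly_Mapping.single (m + n - 1) (c * (of_int n * d))
          + Poly_Mapping.single (m + n - 1) (of_int m * c * d)"
      by (simp add: lderiv_single mult_single algebra_simps)
    then show ?case
      by (simp add: lderiv_single mult_single flip: single_add) (simp add: algebra_simps)
  qed (simp add: lderiv_add algebra_simps)
qed (simp add: lderiv_add algebra_simps)

lemma lderiv_diff: "lderiv (f - g) = lderiv f - lderiv g"
  by (rule poly_mapping_eqI) (simp add: lookup_lderiv lookup_minus algebra_simps)

lemma lderiv_const [simp]: "lderiv (Poly_Mapping.single 0 c) = 0"
  by (simp add: lderiv_single)

lemma lderiv_lin [simp]: "lderiv (lin x) = 1"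
  by (simp add: lin_def lderiv_diff lderiv_single)

lemma lderiv_power_lin: "lderiv (lin x ^ n) = of_nat n * lin x ^ (n - 1)"
proof (induction n)
  case 0
  then show ?case by (simp flip: single_one)
next
  case (Suc n)
  then show ?case by (cases n) (simp_all add: lderiv_mult algebra_simps)
qed

text \<open>
  Integrating term by term meets one obstruction, the coefficient of \<open>t^(-1)\<close>, since \<open>n + 1\<close> is
  invertible in characteristic \<open>0\<close> for every other exponent \<open>n\<close>.
\<close>
lemma ex_antiderivative:
  fixes h :: "'a::field_char_0 laurent"
  assumes "Poly_Mapping.lookup h (-1) = 0"
  obtains g where "lderiv g = h"
proof
  have *: "of_int (n + 1) \<noteq> (0::'a)" if "n \<in> Poly_Mapping.keys h" for n
  proof
    assume "of_int (n + 1) = (0::'a)"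
    then have "n = - 1" by (simp only: of_int_eq_0_iff)
    with that assms show False by (simp add: in_keys_iff)
  qed
  have "(\<Sum>n\<in>Poly_Mapping.keys h.
          lderiv (Poly_Mapping.single (n + 1) (Poly_Mapping.lookup h n / of_int (n + 1)))) =
        (\<Sum>n\<in>Poly_Mapping.keys h. Poly_Mapping.single n (Poly_Mapping.lookup h n))"
    using * by (intro sum.cong) (simp_all add: lderiv_single del: of_int_add)
  then show "lderiv (\<Sum>n\<in>Poly_Mapping.keys h.
      Poly_Mapping.single (n + 1) (Poly_Mapping.lookup h n / of_int (n + 1))) = h"
    by (simp only: lderiv_sum sum_single_lookup)
qed

lemma lookup_const_mult:
  "Poly_Mapping.lookup (lconst c * f) n = c * Poly_Mapping.lookup (f :: 'a::field laurent) n"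
proof (induction f rule: laurent_induct)
  case (single m d)
  then show ?case by (simp add: mult_single lookup_single when_def)
qed (simp add: lookup_add algebra_simps)

lemma lookup_mult_single:
  "Poly_Mapping.lookup (f * Poly_Mapping.single k 1) n =
    Poly_Mapping.lookup (f :: 'a::field laurent) (n - k)"
proof (induction f rule: laurent_induct)
  case (single m c)
  then show ?case by (auto simp: mult_single lookup_single when_def)
qed (simp add: lookup_add algebra_simps)

section \<open>Polynomials inside Laurent polynomials\<close>

lemma laurent_of_poly_lookup:
  "Poly_Mapping.lookup (laurent_of_poly p) n = (if n \<ge> 0 then coeff p (nat n) else 0)"
proof -
  have "Poly_Mapping.lookup (laurent_of_poly p) n =
      (\<Sum>i\<le>Polynomial.degree p. if int i = n then coeff p i else 0)"
    by (simp add: laurent_of_poly_def lookup_sum lookup_single when_def)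
  also have "\<dots> = (if n \<ge> 0 then coeff p (nat n) else 0)"
  proof (cases "n \<ge> 0")
    case True
    then have "(\<Sum>i\<le>Polynomial.degree p. if int i = n then coeff p i else 0) =
       (\<Sum>i\<le>Polynomial.degree p. if i = nat n then coeff p i else 0)"
      by (intro sum.cong) auto
    with True show ?thesis by (simp add: sum.delta coeff_eq_0)
  next
    case False
    then show ?thesis by (intro trans[OF sum.neutral]) auto
  qed
  finally show ?thesis .
qed

lemma laurent_of_poly_add: "laurent_of_poly (p + q) = laurent_of_poly p + laurent_of_poly q"
  by (rule poly_mapping_eqI) (simp add: laurent_of_poly_lookup lookup_add)

lemma laurent_of_poly_diff: "laurent_of_poly (p - q) = laurent_of_poly p - laurent_of_poly q"
  by (rule poly_mapping_eqI) (simp add: laurent_of_poly_lookup lookup_minus)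

lemma laurent_of_poly_monom: "laurent_of_poly (monom c n) = Poly_Mapping.single (int n) c"
  by (rule poly_mapping_eqI) (auto simp: laurent_of_poly_lookup lookup_single when_def)

lemma laurent_of_poly_eq_iff [simp]: "laurent_of_poly p = laurent_of_poly q \<longleftrightarrow> p = q"
proof
  assume *: "laurent_of_poly p = laurent_of_poly q"
  show "p = q"
  proof (rule poly_eqI)
    fix n show "coeff p n = coeff q n"
      using arg_cong[OF *, of "\<lambda>f. Poly_Mapping.lookup f (int n)"]
      by (simp add: laurent_of_poly_lookup)
  qed
qed simp

lemma laurent_of_poly_0 [simp]: "laurent_of_poly 0 = 0"
  by (simp add: laurent_of_poly_def)

lemma laurent_of_poly_1 [simp]: "laurent_of_poly 1 = 1"
  using laurent_of_poly_monom[of 1 0] by simp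

lemma laurent_of_poly_pCons:
  "laurent_of_poly (pCons c p) =
     Poly_Mapping.single 0 c + Poly_Mapping.single 1 1 * laurent_of_poly p"
  by (rule poly_mapping_eqI)
     (auto simp: laurent_of_poly_lookup lookup_add lookup_single lookup_mult_single
        when_def coeff_pCons mult.commute[of "Poly_Mapping.single _ _"] split: nat.split
        intro!: arg_cong[of _ _ "coeff _"])

lemma laurent_of_poly_mult: "laurent_of_poly (p * q) = laurent_of_poly p * laurent_of_poly q"
proof (induction p)
  case (pCons c p)
  have "laurent_of_poly (smult c q) = Poly_Mapping.single 0 c * laurent_of_poly q"
    by (induction q) (simp_all add: laurent_of_poly_pCons algebra_simps mult_single)
  with pCons show ?case
    by (simp add: laurent_of_poly_add laurent_of_poly_pCons algebra_simps)
qed simp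

lemma laurent_of_poly_power: "laurent_of_poly (p ^ n) = laurent_of_poly p ^ n"
  by (induction n) (simp_all add: laurent_of_poly_mult)

lemma laurent_of_poly_linear: "laurent_of_poly [:- x, 1:] = lin x"
  by (simp add: laurent_of_poly_pCons lin_def single_uminus)

lemma lderiv_laurent_of_poly: "lderiv (laurent_of_poly p) = laurent_of_poly (pderiv p)"
proof (rule poly_mapping_eqI)
  fix n :: int
  consider "n \<ge> 0" | "n = - 1" | "n < - 1" by linarith
  then show "Poly_Mapping.lookup (lderiv (laurent_of_poly p)) n =
      Poly_Mapping.lookup (laurent_of_poly (pderiv p)) n"
    by cases (auto simp: laurent_of_poly_lookup lookup_lderiv coeff_pderiv nat_add_distrib)
qed

text \<open>
  Powers of \<open>t\<close> are units, so every question about divisibility or vanishing of Laurent polynomials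
  can be moved to ordinary polynomials, where roots and their orders are available.
\<close>
lemma ex_laurent_of_poly:
  fixes f :: "'a::field laurent"
  obtains k p where "f = Poly_Mapping.single (- int k) 1 * laurent_of_poly p"
proof -
  have "\<exists>k p. Poly_Mapping.single (int k) 1 * f = laurent_of_poly p"
  proof (induction f rule: laurent_induct)
    case (single n c)
    have "Poly_Mapping.single (int (nat \<bar>n\<bar>)) 1 * Poly_Mapping.single n c
        = laurent_of_poly (monom c (nat (\<bar>n\<bar> + n)))"
      using abs_ge_minus_self[of n] by (simp add: laurent_of_poly_monom mult_single)
    then show ?case by blast
  next
    case (add f g)
    then obtain k p l q where *: "Poly_Mapping.single (int k) 1 * f = laurent_of_poly p"
      "Poly_Mapping.single (int l) 1 * g = laurent_of_poly q" by blast
    have "Poly_Mapping.single (int (k + l)) 1 * (f + g) =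
       Poly_Mapping.single (int l) 1 * (Poly_Mapping.single (int k) 1 * f)
       + Poly_Mapping.single (int k) 1 * (Poly_Mapping.single (int l) 1 * g)"
      by (simp add: algebra_simps mult_single flip: mult.assoc)
    also have "\<dots> = laurent_of_poly (monom 1 l * p + monom 1 k * q)"
      by (simp add: * laurent_of_poly_add laurent_of_poly_mult laurent_of_poly_monom)
    finally show ?case by blast
  qed
  then obtain k p where p: "Poly_Mapping.single (int k) 1 * f = laurent_of_poly p" by blast
  have "f = Poly_Mapping.single (- int k) 1 * laurent_of_poly p"
    unfolding p[symmetric] by (simp add: mult_single flip: mult.assoc)
  then show ?thesis by (rule that)
qed

lemma lin_neq_0 [simp]: "lin x \<noteq> 0"
proof
  assume "lin x = 0"
  then have "Poly_Mapping.lookup (lin x) 1 = 0" by simp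
  then show False by (simp add: lin_def lookup_minus lookup_single)
qed

lemma mem_witt_multiples_iff: "w \<in> witt_multiples f \<longleftrightarrow> f dvd w"
  by (auto simp: witt_multiples_def dvd_def)

text \<open>
  Evaluation at \<open>x\<close> is encoded by the next two lemmas: every Laurent polynomial is congruent to a
  constant modulo \<open>t - x\<close>, and distinct constants are not congruent. The separation of constants
  relies on \<open>x \<noteq> 0\<close>: for \<open>x = 0\<close> the divisor is the unit \<open>t\<close>.
\<close>
lemma not_lin_dvd_const:
  assumes "x \<noteq> 0" "c \<noteq> 0"
  shows "\<not> lin x dvd (Poly_Mapping.single 0 c :: 'a::field laurent)"
proof
  assume "lin x dvd (Poly_Mapping.single 0 c :: 'a laurent)"
  then obtain h where h: "Poly_Mapping.single 0 c = lin x * h" by (auto simp: dvd_def)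
  obtain k p where hp: "h = Poly_Mapping.single (- int k) 1 * laurent_of_poly p"
    by (rule ex_laurent_of_poly)
  have "laurent_of_poly (monom c k) = Poly_Mapping.single (int k) 1 * Poly_Mapping.single 0 c"
    by (simp add: laurent_of_poly_monom mult_single)
  also have "\<dots> =
      Poly_Mapping.single (int k) 1 * Poly_Mapping.single (- int k) 1 * lin x * laurent_of_poly p"
    by (simp only: h hp ac_simps)
  also have "\<dots> = laurent_of_poly ([:- x, 1:] * p)"
    by (simp only: laurent_of_poly_mult laurent_of_poly_linear mult_single) simp
  finally have "monom c k = [:- x, 1:] * p" by (simp only: laurent_of_poly_eq_iff)
  then have "poly (monom c k) x = poly ([:- x, 1:] * p) x" by simp
  with assms show False by (simp add: poly_monom)
qed

lemma ex_residue_mod_lin: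
  fixes f :: "'a::field laurent"
  assumes "x \<noteq> 0"
  obtains c h where "f = lconst c + lin x * h"
proof -
  obtain k p where f: "f = Poly_Mapping.single (- int k) 1 * laurent_of_poly p"
    by (rule ex_laurent_of_poly)
  \<comment> \<open>The value of \<open>t^(-k) p\<close> at \<open>x\<close>; clearing the denominator, \<open>p - c t^k\<close> has the root \<open>x\<close>.\<close>
  define c where "c = poly p x / x ^ k"
  have "poly (p - monom c k) x = 0" using assms by (simp add: c_def poly_monom)
  then obtain q where "p - monom c k = [:- x, 1:] * q" unfolding poly_eq_0_iff_dvd dvd_def by blast
  then have "laurent_of_poly p = laurent_of_poly (monom c k + [:- x, 1:] * q)"
    by (simp add: algebra_simps)
  also have "\<dots> = Poly_Mapping.single (int k) c + lin x * laurent_of_poly q"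
    by (simp only: laurent_of_poly_add laurent_of_poly_mult laurent_of_poly_linear laurent_of_poly_monom)
  finally have "f = lconst c + lin x * (Poly_Mapping.single (- int k) 1 * laurent_of_poly q)"
    by (simp add: f algebra_simps mult_single)
  then show ?thesis by (rule that)
qed

section \<open>The bracket\<close>

lemma witt_bracket_add_right: "witt_bracket f (g + h) = witt_bracket f g + witt_bracket f h"
  by (simp add: witt_bracket_def lderiv_add algebra_simps)

lemma witt_bracket_add_left: "witt_bracket (f + g) h = witt_bracket f h + witt_bracket g h"
  by (simp add: witt_bracket_def lderiv_add algebra_simps)

lemma witt_bracket_const_right: "witt_bracket f (lconst c * g) = lconst c * witt_bracket f g"
  by (simp add: witt_bracket_def lderiv_mult algebra_simps)

lemma witt_bracket_const_left: "witt_bracket (lconst c * f) g = lconst c * witt_bracket f g"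
  by (simp add: witt_bracket_def lderiv_mult algebra_simps)

lemma dvd_witt_bracket: "d dvd f \<Longrightarrow> d dvd g \<Longrightarrow> d dvd witt_bracket f g"
  by (simp add: witt_bracket_def dvd_diff)

text \<open>
  Around \<open>x\<close> the fields \<open>e_n = (t - x)^n \<partial>\<close> multiply like the standard basis of the Lie algebra of
  vector fields on a line; all explicit computations in \<open>K\<close> below are instances of this rule.
\<close>
lemma witt_bracket_lin_power:
  assumes "m + n \<ge> 1"
  shows "witt_bracket (lin x ^ m) (lin x ^ n) = lconst (of_int (int n - int m)) * lin x ^ (m + n - 1)"
proof -
  have "lin x ^ m * (of_nat n * lin x ^ (n - 1)) = of_nat n * lin x ^ (m + n - 1)"
    by (cases n) (simp_all add: power_add)
  moreover have "(of_nat m * lin x ^ (m - 1)) * lin x ^ n = of_nat m * lin x ^ (m + n - 1)"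
    by (cases m) (simp_all add: power_add)
  ultimately show ?thesis
    unfolding witt_bracket_def lderiv_power_lin
    by (simp only: single_diff single_of_nat of_int_diff of_int_of_nat_eq left_diff_distrib)
qed

section \<open>Subalgebras of codimension one in the fields vanishing at a point\<close>

text \<open>
  Given \<open>lin_dvd\<close>, the conditions \<open>dependent\<close> and \<open>proper\<close> say that \<open>K\<close> has codimension exactly one in
  the space of fields that vanish at \<open>x\<close>. They are stated elementwise because this is the form in
  which they are used: to correct an element of \<open>W(t - x)\<close> by a multiple of another one.
\<close>
locale one_point_subalgebra =
  fixes K :: "'a::{alg_closed_field, field_char_0} laurent set" and x :: 'a
  assumes subalgebra: "lie_subalgebra K"
    and x_nonzero: "x \<noteq> 0"
    and lin_dvd: "f \<in> K \<Longrightarrow> lin x dvd f"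
    and dependent: "lin x dvd u \<Longrightarrow> lin x dvd v \<Longrightarrow>
      \<exists>c d. (c \<noteq> 0 \<or> d \<noteq> 0) \<and> lconst c * u + lconst d * v \<in> K"
    and proper: "\<exists>f. lin x dvd f \<and> f \<notin> K"
    and other_points: "y \<noteq> 0 \<Longrightarrow> y \<noteq> x \<Longrightarrow> \<exists>f\<in>K. \<not> lin y dvd f"
begin

lemma add_mem: "f \<in> K \<Longrightarrow> g \<in> K \<Longrightarrow> f + g \<in> K"
  and const_mult_mem: "f \<in> K \<Longrightarrow> lconst c * f \<in> K"
  and bracket_mem: "f \<in> K \<Longrightarrow> g \<in> K \<Longrightarrow> witt_bracket f g \<in> K"
  using subalgebra unfolding lie_subalgebra_def laurent.subspace_def lscale_def by auto

lemma diff_mem: "f \<in> K \<Longrightarrow> g \<in> K \<Longrightarrow> f - g \<in> K"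
  using add_mem[of f "lconst (- 1) * g"] const_mult_mem[of g "- 1"] by (simp add: single_uminus)

lemma const_mult_cancel:
  assumes "lconst c * f \<in> K" "c \<noteq> 0"
  shows "f \<in> K"
  using const_mult_mem[OF assms(1), of "inverse c"] assms(2)
  by (simp add: mult_single flip: mult.assoc)

lemma add_mem_cancel: "f + g \<in> K \<Longrightarrow> f \<in> K \<Longrightarrow> g \<in> K"
  using diff_mem[of "f + g" f] by simp

text \<open>
  \<open>K\<close> acts on the one-dimensional quotient \<open>W(t - x) / K\<close>; this is the kernel of the action. It has
  codimension at most one in \<open>K\<close>, so it is infinite-dimensional.
\<close>
definition stabilizer :: "'a laurent set" where
  "stabilizer = {f \<in> K. \<forall>v. lin x dvd v \<longrightarrow> witt_bracket f v \<in> K}"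

text \<open>
  The two fields \<open>(t - x) t^n\<close> and \<open>(t - x) t^(n+1)\<close> are dependent modulo \<open>K\<close>. Bounding the exponents
  of the combination makes it possible to produce independent elements later: disjoint ranges of
  exponents suffice.
\<close>
lemma ex_mem_short:
  "\<exists>f\<in>K. f \<noteq> 0 \<and> Poly_Mapping.keys f \<subseteq> {n..n + 2}"
proof -
  let ?T = "\<lambda>n. Poly_Mapping.single n (1::'a)"
  obtain c d where cd: "c \<noteq> 0 \<or> d \<noteq> 0"
    and mem: "lconst c * (lin x * ?T n) + lconst d * (lin x * ?T (n + 1)) \<in> K" (is "?f \<in> K")
    using dependent[of "lin x * ?T n" "lin x * ?T (n + 1)"] by auto
  let ?g = "Poly_Mapping.single n c + Poly_Mapping.single (n + 1) d"
  have f: "?f = lin x * ?g" by (simp add: algebra_simps mult_single)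
  have "Poly_Mapping.lookup ?g n = c" "Poly_Mapping.lookup ?g (n + 1) = d"
    by (simp_all add: lookup_add lookup_single)
  with cd have "?g \<noteq> 0" by (metis lookup_zero)
  then have "?f \<noteq> 0" unfolding f by (simp del: mult_eq_0_iff add: no_zero_divisors)
  moreover have "Poly_Mapping.keys ?f \<subseteq> {n..n + 2}"
    unfolding f
    by (auto simp: in_keys_iff lin_def algebra_simps mult_single lookup_add lookup_minus
          lookup_single when_def split: if_splits)
  ultimately show ?thesis using mem by blast
qed

text \<open>
  Choose \<open>e\<close> in \<open>W(t - x)\<close> outside \<open>K\<close>. An element of \<open>K\<close> acts trivially on the quotient as
  soon as its bracket with \<open>e\<close> lies in \<open>K\<close>, and two brackets with \<open>e\<close> are dependent modulo \<open>K\<close>.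
\<close>
lemma ex_stabilizer_short:
  "\<exists>f\<in>stabilizer. f \<noteq> 0 \<and> Poly_Mapping.keys f \<subseteq> {n..n + 5}"
proof -
  obtain e where e: "lin x dvd e" "e \<notin> K" using proper by blast
  obtain f where f: "f \<in> K" "f \<noteq> 0" "Poly_Mapping.keys f \<subseteq> {n..n + 2}"
    using ex_mem_short by blast
  obtain g where g: "g \<in> K" "g \<noteq> 0" "Poly_Mapping.keys g \<subseteq> {n + 3..n + 3 + 2}"
    using ex_mem_short by blast
  obtain c d where cd: "c \<noteq> 0 \<or> d \<noteq> 0"
    and "lconst c * witt_bracket f e + lconst d * witt_bracket g e \<in> K"
    using dependent[of "witt_bracket f e" "witt_bracket g e"] dvd_witt_bracket lin_dvd e f g by blast
  then have we: "witt_bracket (lconst c * f + lconst d * g) e \<in> K" (is "witt_bracket ?w e \<in> K")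
    by (simp add: witt_bracket_add_left witt_bracket_const_left)
  have w: "?w \<in> K" using f g by (intro add_mem const_mult_mem)
  have lookup_w: "Poly_Mapping.lookup ?w m =
      c * Poly_Mapping.lookup f m + d * Poly_Mapping.lookup g m" for m
    by (simp add: lookup_add lookup_const_mult)
  have "witt_bracket ?w v \<in> K" if v: "lin x dvd v" for v
  proof -
    obtain a b where ab: "a \<noteq> 0 \<or> b \<noteq> 0" "lconst a * v + lconst b * e \<in> K"
      using dependent[OF v e(1)] by blast
    have "a \<noteq> 0" using ab e(2) const_mult_cancel[of b e] by auto
    have "lconst a * witt_bracket ?w v + lconst b * witt_bracket ?w e \<in> K"
      using bracket_mem[OF w ab(2)] by (simp add: witt_bracket_add_right witt_bracket_const_right)
    then have "lconst a * witt_bracket ?w v \<in> K"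
      using add_mem_cancel[of "lconst b * witt_bracket ?w e"] const_mult_mem[OF we, of b]
      by (simp add: add.commute)
    then show ?thesis using \<open>a \<noteq> 0\<close> by (rule const_mult_cancel)
  qed
  then have "?w \<in> stabilizer" using w by (simp add: stabilizer_def)
  moreover have "?w \<noteq> 0"
  proof
    assume "?w = 0"
    then have *: "c * Poly_Mapping.lookup f m + d * Poly_Mapping.lookup g m = 0" for m
      using lookup_w by (metis lookup_zero)
    obtain m m' where m: "m \<in> Poly_Mapping.keys f" "m' \<in> Poly_Mapping.keys g"
      using f(2) g(2) by (metis all_not_in_conv keys_eq_empty)
    then have "m \<notin> Poly_Mapping.keys g" "m' \<notin> Poly_Mapping.keys f" using f(3) g(3) by force+
    with m *[of m] *[of m'] cd show False by (auto simp: in_keys_iff)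
  qed
  moreover have "Poly_Mapping.keys ?w \<subseteq> {n..n + 5}"
  proof
    fix m assume "m \<in> Poly_Mapping.keys ?w"
    then have "m \<in> Poly_Mapping.keys f \<or> m \<in> Poly_Mapping.keys g"
      unfolding in_keys_iff lookup_w by auto
    then show "m \<in> {n..n + 5}" using f(3) g(3) by force
  qed
  ultimately show ?thesis by blast
qed

text \<open>
  If \<open>h = k'\<close>, then \<open>[f, g k] + [g, f k] = 2 f g k'\<close>: all derivatives of \<open>f\<close> and \<open>g\<close> cancel.
  This is how a Lie subalgebra comes to contain products, up to the residue condition on \<open>h\<close> that
  makes it a derivative.
\<close>
lemma stabilizer_mult:
  assumes "f \<in> stabilizer" "g \<in> stabilizer" "Poly_Mapping.lookup h (- 1) = 0"
  shows "f * g * h \<in> K"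
proof -
  obtain k where k: "lderiv k = h" using ex_antiderivative assms(3) by blast
  have "witt_bracket f (g * k) \<in> K" "witt_bracket g (f * k) \<in> K"
    using assms(1,2) lin_dvd by (auto simp: stabilizer_def)
  then have "witt_bracket f (g * k) + witt_bracket g (f * k) \<in> K" by (rule add_mem)
  also have "witt_bracket f (g * k) + witt_bracket g (f * k) = f * g * h + f * g * h"
    by (simp add: witt_bracket_def lderiv_mult k algebra_simps)
  also have "\<dots> = lconst 2 * (f * g * h)"
    by (simp only: mult_2 single_numeral)
  finally show ?thesis by (rule const_mult_cancel) simp
qed

text \<open>
  With independent \<open>f\<close> and \<open>g\<close> in the stabilizer, \<open>f f (g h)\<close> lies in \<open>K\<close> when \<open>g h\<close> has
  residue \<open>0\<close>, and \<open>f g (f h)\<close> lies in \<open>K\<close> when \<open>f h\<close> has residue \<open>0\<close>. By independence every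
  \<open>h\<close> is a sum of multipliers of the two kinds, so all multiples of \<open>f f g\<close> lie in \<open>K\<close>.
\<close>
lemma ex_multiples_subset: "\<exists>q. q \<noteq> 0 \<and> (\<forall>h. q * h \<in> K)"
proof -
  obtain f where f: "f \<in> stabilizer" "f \<noteq> 0" "Poly_Mapping.keys f \<subseteq> {0..0 + 5}"
    using ex_stabilizer_short by blast
  obtain g where g: "g \<in> stabilizer" "g \<noteq> 0" "Poly_Mapping.keys g \<subseteq> {6..6 + 5}"
    using ex_stabilizer_short by blast
  obtain m where m: "m \<in> Poly_Mapping.keys f" using f(2) by (metis all_not_in_conv keys_eq_empty)
  let ?r = "\<lambda>h. Poly_Mapping.lookup h (- 1) :: 'a"
  \<comment> \<open>The residues of \<open>f u\<close> and \<open>g u\<close> are the coefficients of \<open>f\<close> and \<open>g\<close> at \<open>m\<close>.\<close>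
  define u where "u = Poly_Mapping.single (- 1 - m) (1 :: 'a)"
  have "m \<notin> Poly_Mapping.keys g" using m f(3) g(3) by force
  then have gu: "?r (g * u) = 0" and fu: "?r (f * u) \<noteq> 0"
    using m by (simp_all add: u_def lookup_mult_single in_keys_iff)
  have "f * f * g * h \<in> K" for h
  proof -
    define s where "s = ?r (f * h) / ?r (f * u)"
    let ?h = "h - lconst s * u"
    have "f * ?h = f * h - lconst s * (f * u)" by (simp add: algebra_simps)
    then have "?r (f * ?h) = 0" using fu by (simp add: lookup_minus lookup_const_mult s_def)
    then have 1: "f * g * (f * ?h) \<in> K" using f g by (intro stabilizer_mult)
    have 2: "f * f * (g * u) \<in> K" using f gu by (intro stabilizer_mult)
    have "f * f * g * h = f * g * (f * ?h) + lconst s * (f * f * (g * u))"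
      by (simp add: algebra_simps)
    then show ?thesis using 1 2 by (simp only: add_mem const_mult_mem)
  qed
  moreover have "f * f * g \<noteq> 0" using f g by simp
  ultimately show ?thesis by blast
qed

section \<open>The conductor\<close>

text \<open>
  The polynomials with this property form an ideal; its monic generator is the conductor.
\<close>
definition conducts :: "'a poly \<Rightarrow> bool" where
  "conducts p \<longleftrightarrow> (\<forall>h. laurent_of_poly p * h \<in> K)"

lemma conducts_iff: "conducts p \<longleftrightarrow> witt_multiples (laurent_of_poly p) \<subseteq> K"
  by (auto simp: conducts_def witt_multiples_def)

lemma conducts_mult: "conducts p \<Longrightarrow> conducts (p * q)"
  by (simp add: conducts_def laurent_of_poly_mult mult.assoc)

lemma conducts_diff: "conducts p \<Longrightarrow> conducts q \<Longrightarrow> conducts (p - q)"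
  by (simp add: conducts_def laurent_of_poly_diff left_diff_distrib diff_mem)

lemma ex_conductor:
  obtains p where "lead_coeff p = 1" "\<And>q. conducts q \<longleftrightarrow> p dvd q"
proof -
  obtain q where q: "q \<noteq> 0" "\<And>h. q * h \<in> K" using ex_multiples_subset by blast
  obtain k p where "q = Poly_Mapping.single (- int k) 1 * laurent_of_poly p"
    by (rule ex_laurent_of_poly)
  with q(1) have p: "p \<noteq> 0" "q * Poly_Mapping.single (int k) 1 = laurent_of_poly p"
    by (auto simp: mult_single ac_simps simp flip: mult.assoc)
  have "laurent_of_poly p * h \<in> K" for h
    unfolding p(2)[symmetric] mult.assoc by (rule q(2))
  then have "p \<noteq> 0 \<and> conducts p" using p(1) by (simp add: conducts_def)
  then obtain p where p: "p \<noteq> 0" "conducts p"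
    and least: "\<And>q. q \<noteq> 0 \<Longrightarrow> conducts q \<Longrightarrow> Polynomial.degree p \<le> Polynomial.degree q"
    using ex_has_least_nat[of "\<lambda>p. p \<noteq> 0 \<and> conducts p" p Polynomial.degree] by blast
  have *: "conducts q \<longleftrightarrow> p dvd q" for q
  proof
    assume "conducts q"
    then have "conducts (q - p * (q div p))" using p(2) by (intro conducts_diff conducts_mult)
    then have "conducts (q mod p)" by (simp add: minus_mult_div_eq_mod)
    then have "q mod p = 0" using least[of "q mod p"] degree_mod_less'[OF p(1), of q] by force
    then show "p dvd q" by (simp add: dvd_eq_mod_eq_0)
  qed (use p(2) conducts_mult in \<open>auto simp: dvd_def\<close>)
  show ?thesis
  proof
    show "lead_coeff (smult (inverse (lead_coeff p)) p) = 1" using p(1) by simp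
    show "conducts q \<longleftrightarrow> smult (inverse (lead_coeff p)) p dvd q" for q
      using p(1) * by (simp add: smult_dvd_iff)
  qed
qed

lemma witt_conductor_eqI:
  assumes "lead_coeff p = 1" "\<And>q. conducts q \<longleftrightarrow> p dvd q"
  shows "witt_conductor K = p"
  unfolding witt_conductor_def conducts_iff[symmetric]
proof (rule the_equality)
  have least: "Polynomial.degree p \<le> Polynomial.degree q" if "lead_coeff q = 1" "conducts q" for q
    using that assms(2) by (intro dvd_imp_degree_le) auto
  have p: "conducts p" using assms(2) by simp
  with assms(1) least show "lead_coeff p = 1 \<and> conducts p \<and>
    (\<forall>q. lead_coeff q = 1 \<and> conducts q \<longrightarrow> Polynomial.degree p \<le> Polynomial.degree q)"
    by blast
  fix q assume q: "lead_coeff q = 1 \<and> conducts q \<and>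
    (\<forall>q'. lead_coeff q' = 1 \<and> conducts q' \<longrightarrow> Polynomial.degree q \<le> Polynomial.degree q')"
  then have deg: "Polynomial.degree q = Polynomial.degree p"
    using least p assms(1) by (simp add: le_antisym)
  from q assms(2) obtain r where r: "q = p * r" by (auto simp: dvd_def)
  from q have "q \<noteq> 0" by auto
  with r deg have "Polynomial.degree r = 0" by (simp add: degree_mult_eq)
  then obtain c where c: "r = [:c:]" by (rule degree_eq_zeroE)
  have "lead_coeff q = lead_coeff p * c" unfolding r lead_coeff_mult by (simp add: c)
  with r c q assms(1) show "q = p" by simp
qed

text \<open>
  For \<open>u\<close> in \<open>K\<close> and \<open>p\<close> in the conductor ideal, \<open>[u, p h] = u p' h + p (u h' - u' h)\<close>, so
  \<open>u p'\<close> is in the ideal as well. At a root \<open>y\<close> of \<open>p\<close> different from \<open>x\<close> and \<open>0\<close> some \<open>u\<close> in \<open>K\<close>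
  does not vanish, and then \<open>u p'\<close> has a smaller order at \<open>y\<close> than \<open>p\<close>, so \<open>p\<close> does not
  generate the ideal. The root \<open>0\<close> is impossible because \<open>t\<close> is a unit.
\<close>
lemma conductor_root:
  assumes "p \<noteq> 0" "\<And>q. conducts q \<longleftrightarrow> p dvd q" "poly p y = 0"
  shows "y = x"
proof (rule ccontr)
  assume "y \<noteq> x"
  have cp: "conducts p" using assms(2) by simp
  have pp: "pderiv p \<noteq> 0"
  proof
    assume "pderiv p = 0"
    then obtain c where "p = [:c:]" using pderiv_iszero by blast
    with assms(1,3) show False by simp
  qed
  have drop: False if "q \<noteq> 0" "conducts q" "Polynomial.order y q < Polynomial.order y p" for q
    using that assms(2)[of q] dvd_imp_order_le[of q p y] by auto
  show False
  proof (cases "y = 0")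
    case True
    obtain q where q: "p = [:- y, 1:] * q"
      using assms(3) unfolding poly_eq_0_iff_dvd dvd_def by blast
    then have "laurent_of_poly p = laurent_of_poly q * Poly_Mapping.single 1 1"
      using True by (simp add: laurent_of_poly_pCons mult.commute)
    then have "laurent_of_poly q = laurent_of_poly p * Poly_Mapping.single (- 1) 1"
      by (simp add: mult.assoc mult_single)
    then have "laurent_of_poly q * h \<in> K" for h
      using cp by (simp add: conducts_def mult.assoc)
    then have "conducts q" by (simp add: conducts_def)
    moreover have "q \<noteq> 0" using q assms(1) by auto
    moreover have "Polynomial.order y p = Suc (Polynomial.order y q)"
      using assms(1) order_power_n_n[of y 1] unfolding q by (subst order_mult) simp_all
    ultimately show False using drop by force
  next
    case False
    then obtain u where u: "u \<in> K" "\<not> lin y dvd u" using other_points \<open>y \<noteq> x\<close> by blast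
    obtain k q where q: "u = Poly_Mapping.single (- int k) 1 * laurent_of_poly q"
      by (rule ex_laurent_of_poly)
    have "poly q y \<noteq> 0"
    proof
      assume "poly q y = 0"
      then have "[:- y, 1:] dvd q" by (simp add: poly_eq_0_iff_dvd)
      then have "lin y dvd laurent_of_poly q"
        by (metis dvd_def laurent_of_poly_linear laurent_of_poly_mult)
      with u(2) q show False by simp
    qed
    have "laurent_of_poly (q * pderiv p) * h \<in> K" for h
    proof -
      let ?h = "Poly_Mapping.single (int k) 1 * h" and ?p = "laurent_of_poly p"
      have u': "laurent_of_poly q = Poly_Mapping.single (int k) 1 * u"
        by (simp add: q mult_single flip: mult.assoc)
      have "laurent_of_poly (q * pderiv p) * h = u * lderiv ?p * ?h"
        by (simp add: laurent_of_poly_mult u' lderiv_laurent_of_poly ac_simps)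
      also have "\<dots> = witt_bracket u (?p * ?h) - ?p * (u * lderiv ?h - lderiv u * ?h)"
        by (simp only: witt_bracket_def lderiv_mult[of ?p ?h]) (simp add: algebra_simps)
      also have "\<dots> \<in> K" using u cp by (intro diff_mem bracket_mem) (auto simp: conducts_def)
      finally show ?thesis .
    qed
    then have "conducts (q * pderiv p)" by (simp add: conducts_def)
    moreover have ne: "q * pderiv p \<noteq> 0" using pp \<open>poly q y \<noteq> 0\<close> by auto
    moreover have "Polynomial.order y (q * pderiv p) < Polynomial.order y p"
      using order_pderiv[OF assms(1,3)] \<open>poly q y \<noteq> 0\<close> by (simp add: order_mult[OF ne] order_0I)
    ultimately show False using drop by blast
  qed
qed

lemma ex_conductor_power:
  obtains a where "\<And>q. conducts q \<longleftrightarrow> [:- x, 1:] ^ a dvd q"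
proof -
  obtain p where p: "lead_coeff p = 1" "\<And>q. conducts q \<longleftrightarrow> p dvd q" using ex_conductor by blast
  then have "p \<noteq> 0" by auto
  then obtain q where q: "p = [:- x, 1:] ^ Polynomial.order x p * q" "\<not> [:- x, 1:] dvd q"
    using order_decomp by blast
  have "Polynomial.degree q = 0"
  proof (rule ccontr)
    assume "Polynomial.degree q \<noteq> 0"
    then obtain y where y: "poly q y = 0" using alg_closed_imp_poly_has_root by blast
    then have "poly p y = 0" by (subst q(1)) simp
    with conductor_root \<open>p \<noteq> 0\<close> p(2) have "y = x" by blast
    with y q(2) show False by (simp add: poly_eq_0_iff_dvd)
  qed
  then obtain c where c: "q = [:c:]" by (rule degree_eq_zeroE)
  then obtain a where a: "p = smult c ([:- x, 1:] ^ a)" using q(1) by auto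
  with \<open>p \<noteq> 0\<close> have "c \<noteq> 0" by auto
  then have "p dvd r \<longleftrightarrow> [:- x, 1:] ^ a dvd r" for r
    by (simp add: a smult_dvd_iff)
  with p(2) that show ?thesis by blast
qed

end

section \<open>Expansion at a point\<close>

lemma vanishing_order_eq:
  assumes "f = lin x ^ n * g" "\<not> lin x dvd g"
  shows "vanishing_order x f = n"
  unfolding vanishing_order_def
proof (rule Greatest_equality)
  show "lin x ^ n dvd f" using assms(1) by simp
  fix m assume m: "lin x ^ m dvd f"
  show "m \<le> n"
  proof (rule ccontr)
    assume "\<not> m \<le> n"
    then have "lin x ^ Suc n dvd lin x ^ m" by (intro le_imp_power_dvd) simp
    then have "lin x ^ Suc n dvd f" using m by (rule dvd_trans)
    then have "lin x ^ n * lin x dvd lin x ^ n * g" using assms(1) by (simp only: power_Suc2)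
    with assms(2) show False by simp
  qed
qed

lemma ex_leading_term:
  assumes "x \<noteq> 0" "\<not> lin x ^ a dvd f"
  obtains n c h where "n < a" "c \<noteq> 0" "f = lin x ^ n * (lconst c + lin x * h)"
proof -
  have "\<exists>n<a. lin x ^ n dvd f \<and> \<not> lin x ^ Suc n dvd f"
    using assms(2)
  proof (induction a)
    case (Suc a)
    then show ?case using less_Suc_eq by blast
  qed simp
  then obtain n where n: "n < a" "\<not> lin x ^ Suc n dvd f" "lin x ^ n dvd f" by blast
  from n(3) obtain g where f: "f = lin x ^ n * g" by (elim dvdE)
  obtain c h where g: "g = lconst c + lin x * h" using ex_residue_mod_lin assms(1) by blast
  have "c \<noteq> 0"
  proof
    assume "c = 0"
    then have "f = lin x ^ Suc n * h" using f g by (simp add: ac_simps)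
    with n(2) show False by simp
  qed
  with n(1) f g that show ?thesis by blast
qed

lemma not_lin_dvd_unit_residue:
  assumes "x \<noteq> 0" "c \<noteq> 0"
  shows "\<not> lin x dvd lconst c + lin x * h"
  using not_lin_dvd_const[OF assms] by (simp add: dvd_add_left_iff)

section \<open>Subalgebras with conductor a power of t - x\<close>

locale conductor_exponent = one_point_subalgebra +
  fixes a :: nat
  assumes conducts_power_iff: "conducts q \<longleftrightarrow> [:- x, 1:] ^ a dvd q"
begin

lemma power_mult_mem: "lin x ^ a * h \<in> K"
  using conducts_power_iff[of "[:- x, 1:] ^ a"]
  by (simp add: conducts_def laurent_of_poly_power laurent_of_poly_linear)

lemma power_mem: "n \<ge> a \<Longrightarrow> lin x ^ n \<in> K"
  using power_mult_mem[of "lin x ^ (n - a)"] by (simp flip: power_add)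

lemma exponent_ge_2: "a \<ge> 2"
proof (rule ccontr)
  assume "\<not> a \<ge> 2"
  then have "a = 0 \<or> a = 1" by linarith
  then have "lin x dvd f \<Longrightarrow> lin x ^ a dvd f" for f by auto
  then have "lin x dvd f \<Longrightarrow> f \<in> K" for f by (metis dvdE power_mult_mem)
  with proper show False by blast
qed

text \<open>
  Otherwise every multiple of \<open>(t - x)^(a-1)\<close>, being a multiple of \<open>(t - x)^a\<close> plus a constant times
  \<open>(t - x)^(a-1)\<close>, would be in \<open>K\<close>, against the minimality of the conductor.
\<close>
lemma last_power_not_mem: "lin x ^ (a - 1) \<notin> K"
proof
  assume *: "lin x ^ (a - 1) \<in> K"
  have "lin x ^ (a - 1) * h \<in> K" for h
  proof -
    obtain c g where "h = lconst c + lin x * g" using ex_residue_mod_lin x_nonzero by blast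
    then have "lin x ^ (a - 1) * h = lconst c * lin x ^ (a - 1) + lin x ^ Suc (a - 1) * g"
      by (simp add: algebra_simps)
    also have "\<dots> \<in> K" using * power_mult_mem[of g] exponent_ge_2
      by (intro add_mem const_mult_mem) (simp_all del: power_Suc)
    finally show ?thesis .
  qed
  then have "conducts ([:- x, 1:] ^ (a - 1))"
    by (simp add: conducts_def laurent_of_poly_power laurent_of_poly_linear)
  then have "Polynomial.degree ([:- x, 1:] ^ a) \<le> Polynomial.degree ([:- x, 1:] ^ (a - 1))"
    unfolding conducts_power_iff by (intro dvd_imp_degree_le) auto
  then show False using exponent_ge_2 by (simp add: degree_linear_power)
qed

lemma last_coeff_eq_0: "lconst c * lin x ^ (a - 1) \<in> K \<Longrightarrow> c = 0"
  using const_mult_cancel last_power_not_mem by blast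

text \<open>
  Hence \<open>e_(a-1)\<close> spans \<open>W(t - x)\<close> modulo \<open>K\<close>, and every \<open>e_n\<close> enters \<open>K\<close> after a correction by a
  multiple of it.
\<close>
lemma ex_corrected_power:
  assumes "n \<ge> 1"
  shows "\<exists>\<gamma>. lin x ^ n + lconst \<gamma> * lin x ^ (a - 1) \<in> K"
proof -
  have "lin x dvd lin x ^ n" "lin x dvd lin x ^ (a - 1)"
    using assms exponent_ge_2 by (simp_all add: dvd_power)
  then obtain c d where cd: "c \<noteq> 0 \<or> d \<noteq> 0" "lconst c * lin x ^ n + lconst d * lin x ^ (a - 1) \<in> K"
    using dependent by blast
  have "c \<noteq> 0" using cd last_coeff_eq_0 by auto
  then have "lconst (inverse c) * (lconst c * lin x ^ n + lconst d * lin x ^ (a - 1)) =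
      lin x ^ n + lconst (inverse c * d) * lin x ^ (a - 1)"
    by (simp add: distrib_left mult_single flip: mult.assoc)
  with const_mult_mem[OF cd(2)] show ?thesis by metis
qed

text \<open>
  Let \<open>u = e_1 + \<alpha> e_(a-1)\<close> and \<open>v = e_n + \<gamma> e_(a-1)\<close> be in \<open>K\<close>. Modulo \<open>W((t - x)^a)\<close> the field \<open>u\<close>
  acts like the grading element \<open>e_1\<close>, so \<open>[u, v] - (n - 1) v\<close> is congruent to
  \<open>\<gamma> (a - 1 - n) e_(a-1)\<close>; as \<open>e_(a-1)\<close> is not in \<open>K\<close> and \<open>n < a - 1\<close>, this forces
  \<open>\<gamma> = 0\<close>.
\<close>
lemma middle_power_mem:
  assumes "2 \<le> n" "n + 2 \<le> a"
  shows "lin x ^ n \<in> K"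
proof -
  obtain \<alpha> where u: "lin x ^ 1 + lconst \<alpha> * lin x ^ (a - 1) \<in> K" (is "?u \<in> K")
    using ex_corrected_power by blast
  obtain \<gamma> where v: "lin x ^ n + lconst \<gamma> * lin x ^ (a - 1) \<in> K" (is "?v \<in> K")
    using ex_corrected_power assms by fastforce
  let ?p = "of_int (int n - 1)" and ?r = "of_int (int (a - 1) - 1)" and ?e = "lin x ^ (a - 1)"
  have "witt_bracket ?u ?v = (lconst ?p * lin x ^ n + lconst \<gamma> * (lconst ?r * ?e))
     + (lconst \<alpha> * (lconst (of_int (int n - int (a - 1))) * lin x ^ (a - 1 + n - 1)))"
    using assms witt_bracket_lin_power[of 1 n x] witt_bracket_lin_power[of 1 "a - 1" x]
      witt_bracket_lin_power[of "a - 1" n x] witt_bracket_lin_power[of "a - 1" "a - 1" x]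
    by (simp only: witt_bracket_add_left witt_bracket_add_right witt_bracket_const_left
        witt_bracket_const_right) simp
  moreover have "lin x ^ (a - 1 + n - 1) \<in> K" using assms by (intro power_mem) simp
  ultimately have "lconst ?p * lin x ^ n + lconst \<gamma> * (lconst ?r * ?e) \<in> K"
    using add_mem_cancel[OF _ const_mult_mem[OF const_mult_mem]] bracket_mem[OF u v]
    by (metis add.commute)
  then have "lconst ?p * lin x ^ n + lconst \<gamma> * (lconst ?r * ?e) - lconst ?p * ?v \<in> K"
    using v by (intro diff_mem const_mult_mem)
  also have "lconst ?p * lin x ^ n + lconst \<gamma> * (lconst ?r * ?e) - lconst ?p * ?v
      = lconst \<gamma> * (lconst ?r - lconst ?p) * ?e"
    by (simp only: algebra_simps)
  also have "\<dots> = lconst (\<gamma> * (?r - ?p)) * ?e"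
    by (simp only: mult_single single_diff[symmetric]) simp
  finally have "\<gamma> * (?r - ?p) = 0" by (rule last_coeff_eq_0)
  moreover have "?r - ?p \<noteq> (0::'a)" using assms by (simp only: of_int_diff[symmetric] of_int_eq_0_iff)
  ultimately have "\<gamma> = 0" by simp
  with v show ?thesis by simp
qed

text \<open>
  For \<open>a \<ge> 5\<close> both \<open>e_2\<close> and \<open>e_(a-2)\<close> are in \<open>K\<close>, hence also their bracket
  \<open>(a - 4) e_(a-1)\<close>. For \<open>a = 4\<close> the two fields coincide and there is no contradiction.
\<close>
lemma exponent_le_4: "a \<le> 4"
proof (rule ccontr)
  assume "\<not> a \<le> 4"
  then have "lin x ^ 2 \<in> K" "lin x ^ (a - 2) \<in> K" by (simp_all add: middle_power_mem)
  then have "witt_bracket (lin x ^ 2) (lin x ^ (a - 2)) \<in> K" by (rule bracket_mem)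
  moreover have last: "2 + (a - 2) - 1 = a - 1" using \<open>\<not> a \<le> 4\<close> by simp
  have "witt_bracket (lin x ^ 2) (lin x ^ (a - 2)) =
     lconst (of_int (int (a - 2) - int 2)) * lin x ^ (a - 1)"
    unfolding last[symmetric] by (rule witt_bracket_lin_power) simp
  ultimately have "lconst (of_int (int (a - 2) - int 2)) * lin x ^ (a - 1) \<in> K" by simp
  then have "of_int (int (a - 2) - int 2) = (0::'a)" by (rule last_coeff_eq_0)
  then show False using \<open>\<not> a \<le> 4\<close> by (simp only: of_int_eq_0_iff)
qed

text \<open>
  Every order from \<open>1\<close> to \<open>a - 2\<close> is attained by a corrected power, and the order \<open>a - 1\<close> would put
  \<open>e_(a-1)\<close> into \<open>K\<close>; so \<open>a - 1\<close> is the only exponent that is missing, and \<open>a - 2\<close> the only gap.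
\<close>
lemma orders_eq:
  "{vanishing_order x f | f. f \<in> K - witt_multiples (lin x ^ a) \<and> vanishing_order x f < a} = {1..a - 2}"
  (is "?L = _")
proof
  show "?L \<subseteq> {1..a - 2}"
  proof
    fix m assume "m \<in> ?L"
    then obtain f where f: "m = vanishing_order x f" "f \<in> K" "\<not> lin x ^ a dvd f"
      by (auto simp: mem_witt_multiples_iff)
    then obtain n c h where n: "n < a" "c \<noteq> 0" "f = lin x ^ n * (lconst c + lin x * h)"
      using ex_leading_term x_nonzero by blast
    then have "m = n"
      using f(1) vanishing_order_eq not_lin_dvd_unit_residue x_nonzero by blast
    have "n \<noteq> 0"
      using lin_dvd[OF f(2)] n(3) not_lin_dvd_unit_residue[OF x_nonzero n(2)] by (metis mult_1 power_0)
    moreover have "n \<noteq> a - 1"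
    proof
      assume *: "n = a - 1"
      then have "a = Suc n" using n(1) by simp
      have "f = lin x ^ Suc n * h + lconst c * lin x ^ n" using n(3) by (simp add: algebra_simps)
      then have "f = lin x ^ a * h + lconst c * lin x ^ (a - 1)"
        unfolding \<open>a = Suc n\<close> diff_Suc_1 .
      with f(2) power_mult_mem[of h] add_mem_cancel have "lconst c * lin x ^ (a - 1) \<in> K" by blast
      with n(2) last_coeff_eq_0 show False by blast
    qed
    ultimately show "m \<in> {1..a - 2}" using \<open>m = n\<close> n(1) by auto
  qed
  show "{1..a - 2} \<subseteq> ?L"
  proof
    fix n assume n: "n \<in> {1..a - 2}"
    then obtain \<gamma> where g: "lin x ^ n + lconst \<gamma> * lin x ^ (a - 1) \<in> K" (is "?f \<in> K")
      using ex_corrected_power by auto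
    have "a - 1 = n + Suc (a - 2 - n)" using n by auto
    then have f: "?f = lin x ^ n * (lconst 1 + lin x * (lconst \<gamma> * lin x ^ (a - 2 - n)))" (is "_ = _ * ?g")
      by (simp only: power_add power_Suc) (simp add: algebra_simps)
    have g': "\<not> lin x dvd ?g" using not_lin_dvd_unit_residue[OF x_nonzero, of 1] by auto
    with f have order: "vanishing_order x ?f = n" by (rule vanishing_order_eq)
    have "\<not> lin x ^ a dvd ?f"
    proof
      assume "lin x ^ a dvd ?f"
      moreover have "lin x ^ Suc n dvd lin x ^ a" using n by (intro le_imp_power_dvd) auto
      ultimately have "lin x ^ Suc n dvd ?f" using dvd_trans by blast
      then have "lin x ^ n * lin x dvd lin x ^ n * ?g" unfolding f by (simp only: power_Suc2)
      with g' show False by simp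
    qed
    moreover have "n < a" using n by auto
    ultimately show "n \<in> ?L" using g order
      by (intro CollectI exI[of _ ?f] conjI DiffI) (simp_all only: mem_witt_multiples_iff not_False_eq_True)
  qed
qed

lemma supp_eq: "witt_supp K = {x}"
proof -
  have "y \<in> witt_supp K \<longleftrightarrow> y \<noteq> 0 \<and> (\<forall>f\<in>K. lin y dvd f)" for y
    by (auto simp: witt_supp_def mem_witt_multiples_iff)
  then show ?thesis using lin_dvd x_nonzero other_points by blast
qed

lemma conductor_eq: "witt_conductor K = [:- x, 1:] ^ a"
proof (rule witt_conductor_eqI)
  show "lead_coeff ([:- x, 1:] ^ a) = 1" unfolding lead_coeff_power by simp
qed (rule conducts_power_iff)

lemma gaps_eq:
  assumes "witt_codim K = 2"
  shows "gaps K = (if a = 2 then None else Some {a - 2})"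
proof -
  have "gaps K = (if a = 2 then None else Some ((\<lambda>g. g - 1) ` ({1..a - 1} - {1..a - 2})))"
    by (simp only: gaps_def Let_def supp_eq the_elem_eq conductor_eq degree_linear_power
        laurent_of_poly_power laurent_of_poly_linear orders_eq assms)
  moreover have "{1..a - 1} - {1..a - 2} = {a - 1}" if "a \<noteq> 2"
    using that exponent_ge_2 by auto
  ultimately show ?thesis by (cases "a = 2") auto
qed

lemma ex_expansion:
  assumes "f \<in> K"
  obtains c d e h
    where "f = lconst c * lin x + lconst d * lin x ^ 2 + lconst e * lin x ^ 3 + lin x ^ 4 * h"
proof -
  obtain f1 where "f = lin x * f1" using lin_dvd[OF assms] by (elim dvdE)
  moreover obtain c f2 where "f1 = lconst c + lin x * f2" using ex_residue_mod_lin x_nonzero by blast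
  moreover obtain d f3 where "f2 = lconst d + lin x * f3" using ex_residue_mod_lin x_nonzero by blast
  moreover obtain e f4 where "f3 = lconst e + lin x * f4" using ex_residue_mod_lin x_nonzero by blast
  ultimately have "f = lconst c * lin x + lconst d * lin x ^ 2 + lconst e * lin x ^ 3 + lin x ^ 4 * f4"
    by (simp add: algebra_simps power2_eq_square power3_eq_cube power4_eq_xxxx)
  then show ?thesis by (rule that)
qed

lemma eq_W_square:
  assumes "a = 2"
  shows "K = witt_multiples (lin x ^ 2)"
proof
  show "K \<subseteq> witt_multiples (lin x ^ 2)"
  proof
    fix f assume f: "f \<in> K"
    then obtain c d e h
      where e: "f = lconst c * lin x + lconst d * lin x ^ 2 + lconst e * lin x ^ 3 + lin x ^ 4 * h"
      by (rule ex_expansion)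
    then have *: "f = lin x ^ 2 * (lconst d + lconst e * lin x + lin x ^ 2 * h) + lconst c * lin x"
      by (simp add: algebra_simps power2_eq_square power3_eq_cube power4_eq_xxxx)
    then have "lconst c * lin x ^ (a - 1) \<in> K"
      using f add_mem_cancel[OF _ power_mult_mem] assms by simp
    then have "c = 0" by (rule last_coeff_eq_0)
    with * show "f \<in> witt_multiples (lin x ^ 2)" by (simp add: mem_witt_multiples_iff)
  qed
qed (use power_mult_mem assms in \<open>auto simp: witt_multiples_def\<close>)

lemma unique_correction:
  assumes "u + lconst \<alpha> * lin x ^ (a - 1) \<in> K" "u + lconst \<beta> * lin x ^ (a - 1) \<in> K"
  shows "\<alpha> = \<beta>"
proof -
  have "(u + lconst \<alpha> * lin x ^ (a - 1)) - (u + lconst \<beta> * lin x ^ (a - 1)) \<in> K"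
    using assms by (rule diff_mem)
  then have "lconst (\<alpha> - \<beta>) * lin x ^ (a - 1) \<in> K" by (simp add: single_diff algebra_simps)
  then have "\<alpha> - \<beta> = 0" by (rule last_coeff_eq_0)
  then show ?thesis by simp
qed

lemma W21_generator_mem: "lin x + lconst \<alpha> * lin x ^ 2 \<in> W21 x \<alpha>"
  unfolding W21_def lscale_def mem_witt_multiples_iff
  by (intro CollectI exI[of _ 0] exI[of _ 1]) simp

lemma W22_generator_mem: "lin x + lconst \<alpha> * lin x ^ 3 \<in> W22 x \<alpha>"
  unfolding W22_def lscale_def mem_witt_multiples_iff
  by (rule CollectI, rule exI[of _ 0], rule exI[of _ 1], rule exI[of _ 0]) simp

lemma ex1_W21:
  assumes "a = 3"
  shows "\<exists>!\<alpha>. K = W21 x \<alpha>"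
proof -
  obtain \<alpha> where gen: "lin x + lconst \<alpha> * lin x ^ 2 \<in> K"
    using ex_corrected_power[of 1] assms by auto
  have "K \<subseteq> W21 x \<alpha>"
  proof
    fix f assume f: "f \<in> K"
    then obtain c d e h
      where e: "f = lconst c * lin x + lconst d * lin x ^ 2 + lconst e * lin x ^ 3 + lin x ^ 4 * h"
      by (rule ex_expansion)
    let ?w = "lin x ^ a * (lconst e + lin x * h)" and ?g = "lin x + lconst \<alpha> * lin x ^ 2"
    have *: "f = (?w + lconst c * ?g) + lconst (d - c * \<alpha>) * lin x ^ (a - 1)"
    proof -
      have "lconst (d - c * \<alpha>) = lconst d - lconst c * lconst \<alpha>" by (simp add: single_diff mult_single)
      note eq = this
      show ?thesis unfolding e assms eq by (simp add: algebra_simps eval_nat_numeral)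
    qed
    have "?w + lconst c * ?g \<in> K" by (intro add_mem const_mult_mem power_mult_mem gen)
    with f * have "d - c * \<alpha> = 0" using last_coeff_eq_0 add_mem_cancel by metis
    with * have "f = ?w + lconst c * ?g" by simp
    then show "f \<in> W21 x \<alpha>" unfolding W21_def lscale_def witt_multiples_def assms by blast
  qed
  moreover have "W21 x \<alpha> \<subseteq> K"
  proof
    fix f assume "f \<in> W21 x \<alpha>"
    then obtain h c where "f = lin x ^ a * h + lconst c * (lin x + lconst \<alpha> * lin x ^ 2)"
      unfolding W21_def lscale_def witt_multiples_def assms by blast
    then show "f \<in> K" by (simp only:) (intro add_mem const_mult_mem power_mult_mem gen)
  qed
  ultimately have K_eq: "K = W21 x \<alpha>" by (rule subset_antisym)
  have last: "a - 1 = 2" using assms by simp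
  show ?thesis
  proof (rule ex1I[of _ \<alpha>])
    fix \<beta> assume "K = W21 x \<beta>"
    then have "lin x + lconst \<beta> * lin x ^ 2 \<in> K" using W21_generator_mem by blast
    with gen unique_correction[of "lin x" \<beta> \<alpha>] show "\<beta> = \<alpha>" by (simp only: last)
  qed (rule K_eq)
qed

lemma ex1_W22:
  assumes "a = 4"
  shows "\<exists>!\<alpha>. K = W22 x \<alpha>"
proof -
  obtain \<alpha> where gen: "lin x + lconst \<alpha> * lin x ^ 3 \<in> K"
    using ex_corrected_power[of 1] assms by auto
  have sq: "lin x ^ 2 \<in> K" using middle_power_mem assms by simp
  have "K \<subseteq> W22 x \<alpha>"
  proof
    fix f assume f: "f \<in> K"
    then obtain c d e h
      where e: "f = lconst c * lin x + lconst d * lin x ^ 2 + lconst e * lin x ^ 3 + lin x ^ 4 * h"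
      by (rule ex_expansion)
    let ?w = "lin x ^ a * h" and ?g = "lin x + lconst \<alpha> * lin x ^ 3"
    have *: "f = (?w + lconst c * ?g + lconst d * lin x ^ 2) + lconst (e - c * \<alpha>) * lin x ^ (a - 1)"
    proof -
      have "lconst (e - c * \<alpha>) = lconst e - lconst c * lconst \<alpha>" by (simp add: single_diff mult_single)
      note eq = this
      show ?thesis unfolding e assms eq by (simp add: algebra_simps)
    qed
    have "?w + lconst c * ?g + lconst d * lin x ^ 2 \<in> K"
      by (intro add_mem const_mult_mem power_mult_mem gen sq)
    with f * have "e - c * \<alpha> = 0" using last_coeff_eq_0 add_mem_cancel by metis
    with * have "f = ?w + lconst c * ?g + lconst d * lin x ^ 2" by simp
    then show "f \<in> W22 x \<alpha>" unfolding W22_def lscale_def witt_multiples_def assms by blast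
  qed
  moreover have "W22 x \<alpha> \<subseteq> K"
  proof
    fix f assume "f \<in> W22 x \<alpha>"
    then obtain h c d
      where "f = lin x ^ a * h + lconst c * (lin x + lconst \<alpha> * lin x ^ 3) + lconst d * lin x ^ 2"
      unfolding W22_def lscale_def witt_multiples_def assms by blast
    then show "f \<in> K" by (simp only:) (intro add_mem const_mult_mem power_mult_mem gen sq)
  qed
  ultimately have K_eq: "K = W22 x \<alpha>" by (rule subset_antisym)
  have last: "a - 1 = 3" using assms by simp
  show ?thesis
  proof (rule ex1I[of _ \<alpha>])
    fix \<beta> assume "K = W22 x \<beta>"
    then have "lin x + lconst \<beta> * lin x ^ 3 \<in> K" using W22_generator_mem by blast
    with gen unique_correction[of "lin x" \<beta> \<alpha>] show "\<beta> = \<alpha>" by (simp only: last)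
  qed (rule K_eq)
qed

end

section \<open>Codimension two\<close>

lemma ex_coset_basis:
  assumes "witt_codim K = 2"
  obtains b1 b2 where
    "\<forall>c d. lconst c * b1 + lconst d * b2 \<in> K \<longrightarrow> c = 0 \<and> d = 0"
    "\<forall>w. \<exists>c d. w - (lconst c * b1 + lconst d * b2) \<in> K"
proof -
  obtain B where B: "quotient_basis K B" "card B = 2"
    using assms someI_ex[of "quotient_basis K"]
    by (metis witt_codim_def zero_neq_numeral)
  then obtain b1 b2 where b: "B = {b1, b2}" "b1 \<noteq> b2" by (auto simp: card_2_iff)
  have indep: "\<And>S u. finite S \<and> S \<subseteq> B \<and> (\<Sum>b\<in>S. lscale (u b) b) \<in> K \<Longrightarrow> \<forall>b\<in>S. u b = 0"
    and span: "\<And>w. \<exists>S u. finite S \<and> S \<subseteq> B \<and> w - (\<Sum>b\<in>S. lscale (u b) b) \<in> K"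
    using B(1) unfolding quotient_basis_def by simp_all
  show ?thesis
  proof (rule that; intro allI impI)
    fix c d assume "lconst c * b1 + lconst d * b2 \<in> K"
    then have "(\<Sum>b\<in>B. lscale (if b = b1 then c else d) b) \<in> K"
      using b by (simp add: lscale_def)
    then have "\<forall>b\<in>B. (if b = b1 then c else d) = 0"
      using b(1) by (intro indep) simp
    then show "c = 0 \<and> d = 0" using b by (auto split: if_splits)
  next
    fix w
    obtain S u where S: "finite S" "S \<subseteq> B" "w - (\<Sum>b\<in>S. lscale (u b) b) \<in> K"
      using span by blast
    have "(\<Sum>b\<in>S. lscale (u b) b) = (\<Sum>b\<in>B. lscale (if b \<in> S then u b else 0) b)"
      using S(2) b(1) by (intro sum.mono_neutral_cong_left) (auto simp: lscale_def)
    then have "(\<Sum>b\<in>S. lscale (u b) b) = lconst (if b1 \<in> S then u b1 else 0) * b1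
        + lconst (if b2 \<in> S then u b2 else 0) * b2"
      using b by (simp add: lscale_def)
    with S(3) show "\<exists>c d. w - (lconst c * b1 + lconst d * b2) \<in> K" by auto
  qed
qed

text \<open>
  Evaluation at \<open>x\<close> makes \<open>W(t - x)\<close> a hyperplane, so it cannot be contained in a subspace of
  codimension two.
\<close>
lemma codim_2_proper:
  assumes "witt_codim K = 2" "x \<noteq> 0"
  shows "\<exists>f. lin x dvd f \<and> f \<notin> K"
proof (rule ccontr)
  assume "\<not> ?thesis"
  then have *: "lin x * f \<in> K" for f by auto
  obtain b1 b2 where indep: "\<forall>c d. lconst c * b1 + lconst d * b2 \<in> K \<longrightarrow> c = 0 \<and> d = 0"
    by (rule ex_coset_basis[OF assms(1)])
  obtain c1 h1 where b1: "b1 = lconst c1 + lin x * h1" using ex_residue_mod_lin assms(2) by blast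
  obtain c2 h2 where b2: "b2 = lconst c2 + lin x * h2"
    using ex_residue_mod_lin assms(2) by blast
  have "lconst c2 * b1 + lconst (- c1) * b2 = lin x * (lconst c2 * h1 - lconst c1 * h2)"
    unfolding b1 b2 by (simp add: algebra_simps mult_single single_uminus)
  then have "lconst c2 * b1 + lconst (- c1) * b2 \<in> K" by (simp only: *)
  then have "c1 = 0" using indep by (metis neg_equal_0_iff_equal)
  then have "lconst 1 * b1 + lconst 0 * b2 \<in> K" using *[of h1] by (simp add: b1)
  then show False using indep by (metis one_neq_zero)
qed

text \<open>
  The three fields \<open>1\<close>, \<open>u\<close>, \<open>v\<close> are dependent modulo \<open>K\<close>. Since all of \<open>K\<close> vanishes at \<open>x\<close>,
  as do \<open>u\<close> and \<open>v\<close>, the field \<open>1\<close> does not take part in the dependence.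
\<close>
lemma codim_2_dependent:
  assumes "laurent.subspace K" "witt_codim K = 2" "x \<noteq> 0" "K \<subseteq> witt_multiples (lin x)"
    and "lin x dvd u" "lin x dvd v"
  shows "\<exists>c d. (c \<noteq> 0 \<or> d \<noteq> 0) \<and> lconst c * u + lconst d * v \<in> K"
proof -
  obtain b1 b2 where span: "\<forall>w. \<exists>c d. w - (lconst c * b1 + lconst d * b2) \<in> K"
    by (rule ex_coset_basis[OF assms(2)])
  have comb: "lconst c * f + lconst d * g \<in> K" if "f \<in> K" "g \<in> K" for c d f g
    using laurent.subspace_add[OF assms(1) laurent.subspace_scale[OF assms(1) that(1), of c]
      laurent.subspace_scale[OF assms(1) that(2), of d]] by (simp only: lscale_def)
  obtain p0 q0 where 0: "1 - (lconst p0 * b1 + lconst q0 * b2) \<in> K" using span by blast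
  obtain p1 q1 where 1: "u - (lconst p1 * b1 + lconst q1 * b2) \<in> K" using span by blast
  obtain p2 q2 where 2: "v - (lconst p2 * b1 + lconst q2 * b2) \<in> K" using span by blast
  \<comment> \<open>The coordinates of the cross product give a relation between \<open>1\<close>, \<open>u\<close> and \<open>v\<close>
    modulo \<open>K\<close>; \<open>D\<close> is the coefficient of \<open>1\<close>.\<close>
  define D where "D = p1 * q2 - p2 * q1"
  let ?c = "p2 * q0 - p0 * q2" and ?d = "p0 * q1 - p1 * q0"
  have "lconst 1 * (lconst ?c * (u - (lconst p1 * b1 + lconst q1 * b2))
      + lconst ?d * (v - (lconst p2 * b1 + lconst q2 * b2)))
      + lconst D * (1 - (lconst p0 * b1 + lconst q0 * b2)) \<in> K"
    by (intro comb 0 1 2)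
  also have "lconst 1 * (lconst ?c * (u - (lconst p1 * b1 + lconst q1 * b2))
      + lconst ?d * (v - (lconst p2 * b1 + lconst q2 * b2)))
      + lconst D * (1 - (lconst p0 * b1 + lconst q0 * b2)) = lconst ?c * u + lconst ?d * v + lconst D"
  proof -
    have "lconst D = lconst p1 * lconst q2 - lconst p2 * lconst q1"
      "lconst ?c = lconst p2 * lconst q0 - lconst p0 * lconst q2"
      "lconst ?d = lconst p0 * lconst q1 - lconst p1 * lconst q0"
      by (simp_all add: D_def single_diff mult_single)
    note expand = this
    show ?thesis unfolding expand by (simp add: algebra_simps)
  qed
  finally have "lin x dvd lconst ?c * u + lconst ?d * v + lconst D"
    using assms(4) by (auto simp: mem_witt_multiples_iff)
  then have "lin x dvd lconst D" using assms(5,6) by (simp add: dvd_add_right_iff)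
  then have "D = 0" using not_lin_dvd_const assms(3) by blast
  then have D: "p1 * q2 = p2 * q1" by (simp add: D_def)
  have "lconst q2 * (u - (lconst p1 * b1 + lconst q1 * b2))
      + lconst (- q1) * (v - (lconst p2 * b1 + lconst q2 * b2)) \<in> K" by (rule comb[OF 1 2])
  also have "lconst q2 * (u - (lconst p1 * b1 + lconst q1 * b2))
      + lconst (- q1) * (v - (lconst p2 * b1 + lconst q2 * b2)) = lconst q2 * u + lconst (- q1) * v
      - (lconst q2 * lconst p1 - lconst q1 * lconst p2) * b1
      - (lconst q2 * lconst q1 - lconst q1 * lconst q2) * b2"
    by (simp add: algebra_simps single_uminus)
  also have "\<dots> = lconst q2 * u + lconst (- q1) * v" using D by (simp add: mult_single mult.commute)
  finally have q: "lconst q2 * u + lconst (- q1) * v \<in> K" .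
  have "lconst p2 * (u - (lconst p1 * b1 + lconst q1 * b2))
      + lconst (- p1) * (v - (lconst p2 * b1 + lconst q2 * b2)) \<in> K" by (rule comb[OF 1 2])
  also have "lconst p2 * (u - (lconst p1 * b1 + lconst q1 * b2))
      + lconst (- p1) * (v - (lconst p2 * b1 + lconst q2 * b2)) = lconst p2 * u + lconst (- p1) * v
      - (lconst p2 * lconst p1 - lconst p1 * lconst p2) * b1
      - (lconst p2 * lconst q1 - lconst p1 * lconst q2) * b2"
    by (simp add: algebra_simps single_uminus)
  also have "\<dots> = lconst p2 * u + lconst (- p1) * v" using D by (simp add: mult_single mult.commute)
  finally have p: "lconst p2 * u + lconst (- p1) * v \<in> K" .
  show ?thesis
  proof (cases "p1 = 0 \<and> q1 = 0")
    case True
    then have "lconst 1 * u + lconst 0 * v \<in> K" using 1 by simp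
    then show ?thesis by (metis one_neq_zero)
  next
    case False
    then show ?thesis using p q by (metis neg_equal_0_iff_equal)
  qed
qed

theorem proposition6p2p2:
  fixes K :: "'a::{alg_closed_field, field_char_0} laurent set"
  assumes "uncountable (UNIV :: 'a set)"
    and "lie_subalgebra K"
    and "witt_codim K = 2"
    and "card (witt_supp K) = 1"
  shows "\<exists>x. x \<noteq> 0 \<and> witt_supp K = {x} \<and>
           (K = witt_multiples (lin x ^ 2) \<or> gaps K = Some {1} \<or> gaps K = Some {2}) \<and>
           (gaps K = Some {1} \<longrightarrow> (\<exists>!\<alpha>. K = W21 x \<alpha>)) \<and>
           (gaps K = Some {2} \<longrightarrow> (\<exists>!\<alpha>. K = W22 x \<alpha>))"
proof -
  obtain x where supp: "witt_supp K = {x}" using assms(4) by (rule card_1_singletonE)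
  then have x: "x \<noteq> 0" "K \<subseteq> witt_multiples (lin x)" by (auto simp: witt_supp_def)
  have others: "\<exists>f\<in>K. \<not> lin y dvd f" if "y \<noteq> 0" "y \<noteq> x" for y
    using supp that by (auto simp: witt_supp_def mem_witt_multiples_iff subset_iff)
  have sub: "laurent.subspace K" using assms(2) by (simp add: lie_subalgebra_def)
  interpret one_point_subalgebra K x
  proof
    show "\<exists>c d. (c \<noteq> 0 \<or> d \<noteq> 0) \<and> lconst c * u + lconst d * v \<in> K"
      if "lin x dvd u" "lin x dvd v" for u v
      using codim_2_dependent[OF sub assms(3) x that] .
  qed (use assms(2,3) x others codim_2_proper in \<open>auto simp: mem_witt_multiples_iff\<close>)
  obtain a where "\<And>q. conducts q \<longleftrightarrow> [:- x, 1:] ^ a dvd q" by (rule ex_conductor_power) blast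
  then interpret conductor_exponent K x a by unfold_locales
  from exponent_ge_2 exponent_le_4 consider "a = 2" | "a = 3" | "a = 4" by linarith
  then show ?thesis
  proof cases
    case 1
    then show ?thesis using x(1) supp eq_W_square gaps_eq[OF assms(3)] by auto
  next
    case 2
    then show ?thesis using x(1) supp ex1_W21 gaps_eq[OF assms(3)] by auto
  next
    case 3
    then show ?thesis using x(1) supp ex1_W22 gaps_eq[OF assms(3)] by auto
  qed
qed

end
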